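(* Let $f:\mathbb{R}^n\to\mathbb{R}^n$ be continuously differentiable with Jacobian $J(x)=\frac{\partial f}{\partial x}(x)$, let $L_1,\dots,L_n\in\mathbb{R}^{N\times N}$ be symmetric positive semidefinite generalized graph Laplacians (so $L_k 1_N=0$), let $\lambda_2^{(k)}$ be the second smallest eigenvalue of $L_k$, and consider the system $$\dot X = F(X)-\Big(\sum_{k=1}^n L_k\otimes E_k\Big)X,\qquad X=[x_1^T\ \cdots\ x_N^T]^T,\quad F(X)=[f(x_1)^T\ \cdots\ f(x_N)^T]^T,$$ where $x_i\in\mathbb{R}^n$ and $E_k=e_ke_k^T\in\mathbb{R}^{n\times n}$. Suppose there exist a convex set $\mathcal{X}\subseteq\mathbb{R}^n$, a (symmetric) positive definite matrix $P\in\mathbb{R}^{n\times n}$, and a constant $\epsilon>0$ such that $$P\Big(J(x)-\sum_{k=1}^n\lambda_2^{(k)}E_k\Big)+\Big(J(x)-\sum_{k=1}^n\lambda_2^{(k)}E_k\Big)^TP\preceq-\epsilon I\qquad\text{for all }x\in\mathcal{X},$$ $$PE_k+E_kP\succeq 0\qquad\text{for each }k\in\{1,\dots,n\}\text{ with }L_k\neq 0.$$ Then for every solution $X:[0,\infty)\to\mathbb{R}^{nN}$ of the system with $x_i(t)\in\mathcal{X}$ for all $t\ge 0$ and all $i\in\{1,\dots,N\}$, for any pair $(i,j)\in\{1,\dots,N\}\times\{1,\dots,N\}$ and any index $k\in\{1,\dots,n\}$, $$x_{i,k}(t)-x_{j,k}(t)\to 0\quad\text{exponentially as }t\to\infty.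$$
   Context: The system is the stacked form of a compartmental ODE model with $N$ compartments: for $i=1,\dots,N$ and $k=1,\dots,n$, $$\dot x_{i,k}=f(x_i)_k+\sum_{j\in\mathcal{N}_{i,k}}w_{ij}^{(k)}(x_{j,k}-x_{i,k}),$$ where $x_i\in\mathbb{R}^n$ is the state of compartment $i$, $x_{i,k}$ is its $k$-th component, $f(x_i)_k$ is the $k$-th component of $f(x_i)$, $\mathcal{N}_{i,k}$ is the set of neighbors of the $k$-th component of compartment $i$ (in an undirected graph depending on $k$), and $w_{ij}^{(k)}=w_{ji}^{(k)}\in\mathbb{R}$ are weights. For each $k$, $L_k\in\mathbb{R}^{N\times N}$ is the corresponding generalized graph Laplacian: for $i\ne j$, $(L_k)_{ij}=-w_{ij}^{(k)}$ if $j\in\mathcal{N}_{i,k}$ and $0$ otherwise, and $(L_k)_{ii}=\sum_{j\in\mathcal{N}_{i,k}}w_{ij}^{(k)}$. It is assumed symmetric positive semidefinite. If the $k$-th components are not interconnected, $L_k=0$. Eigenvalues are counted with multiplicity, so $z^TL_kz\ge\lambda_2^{(k)}z^Tz$ for all $z\in\mathbb{R}^N$ with $z\perp 1_N$. Here $1_N\in\mathbb{R}^N$ is the all-ones vector, $e_k$ is the $k$-th standard basis vector of $\mathbb{R}^n$, $\otimes$ is the Kronecker product, and $\preceq,\succeq$ denote the semidefinite order on symmetric matrices. "$g(t)\to0$ exponentially" means there are constants $C,c>0$ with $|g(t)|\le Ce^{-ct}$ for all $t\ge0$. *)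

theory Defs
  imports "HOL-Analysis.Analysis" "HOL-Computational_Algebra.Polynomial"
begin

definition symmetric_matrix :: "real^'a^'a \<Rightarrow> bool" where
  "symmetric_matrix A \<longleftrightarrow> transpose A = A"

definition psd_matrix :: "real^'a^'a \<Rightarrow> bool" where
  "psd_matrix A \<longleftrightarrow> symmetric_matrix A \<and> (\<forall>z. 0 \<le> z \<bullet> (A *v z))"

definition pd_matrix :: "real^'a^'a \<Rightarrow> bool" where
  "pd_matrix A \<longleftrightarrow> symmetric_matrix A \<and> (\<forall>z. z \<noteq> 0 \<longrightarrow> 0 < z \<bullet> (A *v z))"

definition loewner_le :: "real^'a^'a \<Rightarrow> real^'a^'a \<Rightarrow> bool"  (infix \<open>\<preceq>\<^sub>L\<close> 50) where
  "A \<preceq>\<^sub>L B \<longleftrightarrow> symmetric_matrix A \<and> symmetric_matrix B \<and> psd_matrix (B - A)"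

definition kronecker :: "real^'b::finite^'a::finite \<Rightarrow> real^'d::finite^'c::finite \<Rightarrow>
    real^('b \<times> 'd)^('a \<times> 'c)"
    (infixl \<open>\<otimes>\<^sub>K\<close> 75) where
  "A \<otimes>\<^sub>K B = (\<chi> p q. A $ fst p $ fst q * B $ snd p $ snd q)"

definition unit_matrix :: "'n \<Rightarrow> real^'n^'n" where
  "unit_matrix k = (\<chi> i j. axis k 1 $ i * axis k 1 $ j)"

text \<open>Eigenvalues of a matrix, repeated according to algebraic multiplicity.  Only real roots are
  listed by \<^const>\<open>proots\<close> over the reals, which loses nothing for symmetric matrices.\<close>

definition char_polynomial :: "real^'a^'a \<Rightarrow> real poly" where
  "char_polynomial A = det (mat [:0, 1:] - (\<chi> i j. [:A $ i $ j:]))"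

definition sorted_eigenvalues :: "real^'a^'a \<Rightarrow> real list" where
  "sorted_eigenvalues A = sorted_list_of_multiset (proots (char_polynomial A))"

text \<open>The list is indexed from 0.  For a \<open>1 \<times> 1\<close> matrix there is no second eigenvalue and the
  value below is unspecified.\<close>

definition second_smallest_eigenvalue :: "real^'a^'a \<Rightarrow> real" where
  "second_smallest_eigenvalue A = sorted_eigenvalues A ! 1"

text \<open>Generalized Laplacian of an undirected loop-free graph, given by its neighbour sets, whose
  edge weights are symmetric but may have any sign.\<close>

definition laplacian :: "('a \<Rightarrow> 'a set) \<Rightarrow> ('a \<Rightarrow> 'a \<Rightarrow> real) \<Rightarrow> real^'a^'a" where
  "laplacian nbr w =
     (\<chi> i j. if i = j then (\<Sum>l\<in>nbr i. w i l) else if j \<in> nbr i then - w i j else 0)"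

definition generalized_laplacian :: "real^'a^'a \<Rightarrow> bool" where
  "generalized_laplacian L \<longleftrightarrow>
     (\<exists>nbr w. (\<forall>i. i \<notin> nbr i) \<and> (\<forall>i j. j \<in> nbr i \<longleftrightarrow> i \<in> nbr j) \<and>
       (\<forall>i. \<forall>j\<in>nbr i. w i j = w j i) \<and> L = laplacian nbr w)"

text \<open>A stacked vector is indexed by pairs (compartment, component); this matches the index set
  produced by \<^const>\<open>kronecker\<close>.\<close>

definition block :: "real^('a::finite \<times> 'n::finite) \<Rightarrow> 'a \<Rightarrow> real^'n" where
  "block X i = (\<chi> k. X $ (i, k))"

definition stacked_map ::
  "(real^'n::finite \<Rightarrow> real^'n) \<Rightarrow> real^('a::finite \<times> 'n) \<Rightarrow> real^('a \<times> 'n)" where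
  "stacked_map f X = (\<chi> p. f (block X (fst p)) $ snd p)"

text \<open>At \<open>t = 0\<close> the derivative is one-sided.\<close>

definition compartmental_solution ::
  "(real^'n \<Rightarrow> real^'n) \<Rightarrow> ('n \<Rightarrow> real^'a^'a) \<Rightarrow> (real \<Rightarrow> real^('a::finite \<times> 'n::finite)) \<Rightarrow> bool" where
  "compartmental_solution f L X \<longleftrightarrow>
     (\<forall>t\<ge>0. (X has_vector_derivative
        (stacked_map f (X t) - (\<Sum>k\<in>UNIV. L k \<otimes>\<^sub>K unit_matrix k) *v X t)) (at t within {0..}))"

definition continuously_differentiable :: "(real^'n \<Rightarrow> real^'n) \<Rightarrow> bool" where
  "continuously_differentiable f \<longleftrightarrow>
     (\<forall>x. f differentiable (at x)) \<and> continuous_on UNIV (\<lambda>x. jacobian f (at x))"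

definition tends_to_0_exponentially :: "(real \<Rightarrow> real) \<Rightarrow> bool" where
  "tends_to_0_exponentially g \<longleftrightarrow> (\<exists>C>0. \<exists>c>0. \<forall>t\<ge>0. \<bar>g t\<bar> \<le> C * exp (- c * t))"

lemma laplacian_ones:
  assumes "\<And>i. i \<notin> nbr i"
  shows "laplacian nbr w *v (\<chi> i. 1) = 0"
proof -
  have "(\<Sum>j\<in>UNIV. laplacian nbr w $ i $ j) = 0" for i
  proof -
    have "(\<Sum>j\<in>UNIV. laplacian nbr w $ i $ j) =
        (\<Sum>l\<in>nbr i. w i l) + (\<Sum>j\<in>UNIV - {i}. if j \<in> nbr i then - w i j else 0)"
      by (subst sum.remove[of _ i]) (auto simp: laplacian_def intro!: sum.cong)
    also have "(\<Sum>j\<in>UNIV - {i}. if j \<in> nbr i then - w i j else 0) = (\<Sum>j\<in>nbr i. - w i j)"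
      using assms by (intro sum.mono_neutral_cong_right) auto
    finally show ?thesis by (simp add: sum_negf)
  qed
  then show ?thesis by (simp add: vec_eq_iff matrix_vector_mult_def)
qed

lemma compartmental_component:
  "(stacked_map f X - (\<Sum>k\<in>UNIV. L k \<otimes>\<^sub>K unit_matrix k) *v X) $ (i, k) =
     f (block X i) $ k - (L k *v (\<chi> j. X $ (j, k))) $ i"
proof -
  have "(\<Sum>l\<in>UNIV. (L l \<otimes>\<^sub>K unit_matrix l) $ (i, k) $ (j, m)) = (if m = k then L k $ i $ j else 0)"
    for j m
  proof -
    have "(\<Sum>l\<in>UNIV. (L l \<otimes>\<^sub>K unit_matrix l) $ (i, k) $ (j, m)) =
        (\<Sum>l\<in>UNIV. if l = k then (if m = k then L k $ i $ j else 0) else 0)"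
      by (intro sum.cong) (auto simp: kronecker_def unit_matrix_def axis_def)
    then show ?thesis by simp
  qed
  then have "((\<Sum>l\<in>UNIV. L l \<otimes>\<^sub>K unit_matrix l) *v X) $ (i, k) =
      (\<Sum>j\<in>UNIV. \<Sum>m\<in>UNIV. (if m = k then L k $ i $ j else 0) * X $ (j, m))"
    by (simp add: matrix_vector_mult_def sum.cartesian_product flip: UNIV_Times_UNIV)
       (intro sum.cong, auto)
  also have "\<dots> = (\<Sum>j\<in>UNIV. L k $ i $ j * X $ (j, k))"
    by (simp add: if_distrib[of "\<lambda>u. u * _"] cong: if_cong)
  finally show ?thesis
    by (simp add: stacked_map_def matrix_vector_mult_def)
qed

end

theory Submission
  imports Defs
begin

text \<open>With \<open>y\<^sub>i\<close> the deviation of \<open>x\<^sub>i\<close> from the average \<open>m\<close> of the compartments,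
  \<open>V = \<Sum>\<^sub>i y\<^sub>i\<^sup>T P y\<^sub>i\<close> decays exponentially.  As \<open>\<Sum>\<^sub>i y\<^sub>i = 0\<close>, one may replace \<open>f(x\<^sub>i)\<close> by
  \<open>f(x\<^sub>i) - f(m)\<close> in \<open>V'\<close>, and the mean value theorem along the segment from \<open>m\<close> to \<open>x\<^sub>i\<close> turns
  this into a Jacobian at a point of the convex set.  If \<open>L\<^sub>k \<noteq> 0\<close>, the condition \<open>P E\<^sub>k + E\<^sub>k P \<succeq> 0\<close> forces
  \<open>P E\<^sub>k = P\<^sub>k\<^sub>k E\<^sub>k\<close>, so the coupling through \<open>L\<^sub>k\<close> contributes
  \<open>P\<^sub>k\<^sub>k z\<^sup>T L\<^sub>k z \<ge> P\<^sub>k\<^sub>k \<lambda>\<^sub>2 z\<^sup>T z\<close>, where \<open>z\<close> collects the \<open>k\<close>-th components of the deviations.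
  For the last inequality no spectral theorem is needed: if \<open>\<mu>\<close> is the minimum of the form of \<open>L\<^sub>k\<close>
  on unit vectors orthogonal to the all-ones vector, then \<open>x (x - \<mu>)\<close> divides the characteristic
  polynomial, hence \<open>\<lambda>\<^sub>2 \<le> \<mu>\<close>.\<close>

section \<open>Quadratic forms of symmetric matrices and their minimizers\<close>

lemma symmetric_matrix_inner:
  fixes A :: "real^'n^'n"
  assumes "symmetric_matrix A"
  shows "x \<bullet> (A *v y) = (A *v x) \<bullet> y"
  using assms by (metis dot_lmul_matrix symmetric_matrix_def transpose_matrix_vector)

lemma mat_mult_vector: "mat c *v z = c *\<^sub>R z" for z :: "real^'n"
  by (simp add: vec_eq_iff matrix_vector_mult_def mat_def if_distrib[of "\<lambda>u. u * _"] cong: if_cong)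

lemma sum_deviations_from_mean:
  fixes x :: "'i::finite \<Rightarrow> 'b::real_vector"
  shows "(\<Sum>i\<in>UNIV. x i - (\<Sum>j\<in>UNIV. x j) /\<^sub>R CARD('i)) = 0"
  by (simp add: sum_subtractf sum_constant_scaleR del: sum_constant)

text \<open>Along the line the form equals \<open>2 * s * b + s\<^sup>2 * c\<close>, which is
  negative for small \<open>s\<close> of sign opposite to \<open>b\<close> unless
  \<open>b = 0\<close>. Nonnegativity is asked only on this line, so forms that are nonnegative just
  on a subspace are covered.\<close>

lemma nonneg_form_zero_imp_orthogonal:
  fixes A :: "real^'n^'n"
  assumes sym: "symmetric_matrix A" and zero: "x \<bullet> (A *v x) = 0"
    and nonneg: "\<And>s. 0 \<le> (x + s *\<^sub>R y) \<bullet> (A *v (x + s *\<^sub>R y))"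
  shows "y \<bullet> (A *v x) = 0"
proof (rule ccontr)
  define b where "b = y \<bullet> (A *v x)"
  define c where "c = y \<bullet> (A *v y)"
  \<comment> \<open>The sign opposes \<open>b\<close>, and the denominator keeps the quadratic term
    smaller than the linear one.\<close>
  define s where "s = - b / (1 + \<bar>c\<bar>)"
  assume "y \<bullet> (A *v x) \<noteq> 0"
  then have b: "b\<^sup>2 > 0" by (simp add: b_def)
  have "x \<bullet> (A *v y) = b"
    using symmetric_matrix_inner[OF sym, of x y] by (simp add: b_def inner_commute)
  then have "0 \<le> 2 * s * b + s\<^sup>2 * c"
    using nonneg[of s] zero
    by (simp add: matrix_vector_right_distrib matrix_vector_mult_scaleR inner_add_left
        b_def c_def power2_eq_square algebra_simps)
  also have "2 * s * b + s\<^sup>2 * c = b\<^sup>2 / (1 + \<bar>c\<bar>) * (c / (1 + \<bar>c\<bar>) - 2)"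
  proof -
    have "b = - s * (1 + \<bar>c\<bar>)" by (simp add: s_def)
    then have "b\<^sup>2 / (1 + \<bar>c\<bar>) = - s * b" by (simp add: power2_eq_square)
    moreover have "- s * b * (c / (1 + \<bar>c\<bar>)) = s\<^sup>2 * c"
      by (simp add: s_def power2_eq_square)
    ultimately show ?thesis by (simp add: algebra_simps)
  qed
  also have "\<dots> < 0"
  proof (rule mult_pos_neg)
    have "c / (1 + \<bar>c\<bar>) < 2" by (simp add: divide_less_eq) (simp add: abs_if)
    then show "c / (1 + \<bar>c\<bar>) - 2 < 0" by simp
  qed (use b in simp)
  finally show False by simp
qed

text \<open>Compactness of the unit sphere of \<open>T\<close> yields the minimizer, and homogeneity
  of degree two extends the bound to all of \<open>T\<close>. It serves both the Laplacians, on the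
  complement of the all-ones vector, and \<open>P\<close>, on the whole space.\<close>

lemma quadratic_form_attains_min:
  fixes A :: "real^'n^'n"
  assumes T: "subspace T" and "w \<in> T" "w \<noteq> 0"
  obtains v where "v \<in> T" "norm v = 1" "\<And>z. z \<in> T \<Longrightarrow> (v \<bullet> (A *v v)) * (z \<bullet> z) \<le> z \<bullet> (A *v z)"
proof -
  have "compact (sphere 0 1 \<inter> T)"
    by (intro compact_Int_closed closed_subspace T compact_sphere)
  moreover have "w /\<^sub>R norm w \<in> sphere 0 1 \<inter> T"
    using assms by (simp add: subspace_scale)
  moreover have "continuous_on (sphere 0 1 \<inter> T) (\<lambda>z. z \<bullet> (A *v z))"
    by (intro continuous_on_inner continuous_on_id linear_continuous_on matrix_vector_mul_bounded_linear)
  ultimately obtain v where v: "v \<in> sphere 0 1 \<inter> T"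
    and min: "\<And>z. z \<in> sphere 0 1 \<inter> T \<Longrightarrow> v \<bullet> (A *v v) \<le> z \<bullet> (A *v z)"
    using continuous_attains_inf[of "sphere 0 1 \<inter> T" "\<lambda>z. z \<bullet> (A *v z)"] by blast
  have "(v \<bullet> (A *v v)) * (z \<bullet> z) \<le> z \<bullet> (A *v z)" if "z \<in> T" for z
  proof (cases "z = 0")
    case False
    then have "v \<bullet> (A *v v) \<le> (z /\<^sub>R norm z) \<bullet> (A *v (z /\<^sub>R norm z))"
      using that T by (intro min) (simp add: subspace_scale)
    also have "\<dots> = (z \<bullet> (A *v z)) / (z \<bullet> z)"
      by (simp add: matrix_vector_mult_scaleR dot_square_norm power2_eq_square field_simps)
    finally show ?thesis using False by (simp add: pos_le_divide_eq)
  qed simp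
  with v that show thesis by auto
qed

text \<open>With \<open>\<mu>\<close> the minimum, the form of \<open>A - mat \<mu>\<close> is
  nonnegative on \<open>T\<close> and zero at \<open>v\<close>, so the residual
  \<open>A *v v - \<mu> *\<^sub>R v\<close> is orthogonal to \<open>T\<close>. By invariance it lies
  in \<open>T\<close> itself, hence it is zero.\<close>

lemma form_minimizer_eigenvector:
  fixes A :: "real^'n^'n"
  assumes sym: "symmetric_matrix A" and T: "subspace T"
    and inv: "\<And>z. z \<in> T \<Longrightarrow> A *v z \<in> T"
    and v: "v \<in> T" "norm v = 1"
    and min: "\<And>z. z \<in> T \<Longrightarrow> (v \<bullet> (A *v v)) * (z \<bullet> z) \<le> z \<bullet> (A *v z)"
  shows "A *v v = (v \<bullet> (A *v v)) *\<^sub>R v"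
proof -
  define \<mu> where "\<mu> = v \<bullet> (A *v v)"
  define B where "B = A - mat \<mu>"
  have B: "B *v z = A *v z - \<mu> *\<^sub>R z" for z
    by (simp add: B_def matrix_vector_mult_diff_rdistrib mat_mult_vector)
  define w where "w = B *v v"
  have w: "w \<in> T"
    unfolding w_def B using T inv v by (intro subspace_diff subspace_scale) auto
  have "symmetric_matrix B"
    using sym by (auto simp: B_def symmetric_matrix_def transpose_def mat_def vec_eq_iff)
  moreover have "v \<bullet> (B *v v) = 0"
    using v by (simp add: B inner_diff_right \<mu>_def dot_square_norm)
  moreover have "0 \<le> (v + s *\<^sub>R w) \<bullet> (B *v (v + s *\<^sub>R w))" for s
    using min[of "v + s *\<^sub>R w"] T v w
    by (simp add: B inner_diff_right \<mu>_def[symmetric] subspace_add subspace_scale)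
  ultimately have "w \<bullet> (B *v v) = 0" by (rule nonneg_form_zero_imp_orthogonal)
  then have "A *v v = \<mu> *\<^sub>R v" by (simp add: w_def B)
  then show ?thesis by (simp only: \<mu>_def)
qed

section \<open>Characteristic polynomials and their linear factors\<close>

lemma poly_det:
  fixes M :: "'a::comm_ring_1 poly^'n^'n"
  shows "poly (det M) x = det (\<chi> i j. poly (M $ i $ j) x)"
  unfolding det_def by (simp add: poly_sum poly_prod)

lemma poly_char_polynomial: "poly (char_polynomial A) x = det (mat x - A)"
  unfolding char_polynomial_def poly_det
  by (intro arg_cong[of _ _ det]) (simp add: vec_eq_iff mat_def)

lemma det_const_poly: "det (\<chi> i j. [:A $ i $ j:]) = [:det (A :: real^'n^'n):]"
proof -
  have "poly (det (\<chi> i j. [:A $ i $ j:])) = poly [:det A:]"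
    by (simp add: fun_eq_iff poly_det)
  then show ?thesis by (simp only: poly_eq_poly_eq_iff)
qed

text \<open>Replacing two standard basis vectors by \<open>u\<close> and \<open>v\<close> gives a matrix \<open>Q\<close> for which
  \<open>(x I - A) Q\<close> has a column divisible by \<open>x - \<alpha>\<close> and another one divisible by \<open>x - \<beta>\<close>.  This
  also covers \<open>\<alpha> = \<beta>\<close>, where it gives a root of multiplicity two.\<close>

lemma eigenvectors_char_polynomial_dvd:
  fixes A :: "real^'n^'n"
  assumes u: "A *v u = \<alpha> *\<^sub>R u" and v: "A *v v = \<beta> *\<^sub>R v"
    and indep: "u $ p * v $ q \<noteq> u $ q * v $ p"
  shows "[:-\<alpha>, 1:] * [:-\<beta>, 1:] dvd char_polynomial A"
proof -
  have pq: "p \<noteq> q" using indep by auto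
  define C :: "real poly^'n^'n" where "C = mat [:0, 1:] - (\<chi> i j. [:A $ i $ j:])"
  define Q :: "real^'n^'n" where
    "Q = (\<chi> i j. if j = p then u $ i else if j = q then v $ i else if i = j then 1 else 0)"
  define R :: "real poly^'n^'n" where
    "R = (\<chi> i j. if j = p then [:u $ i:] else if j = q then [:v $ i:] else C $ i $ j)"
  define d where "d j = (if j = p then [:-\<alpha>, 1:] else if j = q then [:-\<beta>, 1:] else 1)" for j
  define D :: "real poly^'n^'n" where "D = (\<chi> i j. if i = j then d j else 0)"

  \<comment> \<open>Polynomial form of \<open>(x I - A) z = (x - \<gamma>) z\<close>, checked by
    evaluation at every real \<open>x\<close>.\<close>
  have C_mult: "(\<Sum>l\<in>UNIV. C $ i $ l * [:z $ l:]) = [:z $ i:] * [:-\<gamma>, 1:]"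
    if "A *v z = \<gamma> *\<^sub>R z" for z \<gamma> i
  proof -
    have "(\<Sum>l\<in>UNIV. A $ i $ l * z $ l) = \<gamma> * z $ i"
      using arg_cong[OF that, of "\<lambda>w. w $ i"] by (simp add: matrix_vector_mult_def)
    moreover have "(\<Sum>l\<in>UNIV. (if i = l then x else 0) * z $ l) = x * z $ i" for x
      by (simp add: if_distrib[of "\<lambda>u. u * _"] cong: if_cong)
    moreover have "poly (mat [:0, 1:] $ i $ l) x = (if i = l then x else 0)" for l :: 'n and x :: real
      by (simp add: mat_def)
    ultimately have "poly (\<Sum>l\<in>UNIV. C $ i $ l * [:z $ l:]) x = poly ([:z $ i:] * [:-\<gamma>, 1:]) x" for x
      by (simp add: C_def poly_sum left_diff_distrib right_diff_distrib sum_subtractf mult.commute)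
    then show ?thesis by (intro poly_eq_poly_eq_iff[THEN iffD1] ext)
  qed

  \<comment> \<open>\<open>D\<close> carries the linear factors pulled out of columns
    \<open>p\<close> and \<open>q\<close>; \<open>R\<close> is what remains.\<close>
  have "C ** (\<chi> i j. [:Q $ i $ j:]) = R ** D"
  proof -
    have "(\<Sum>l\<in>UNIV. C $ i $ l * [:Q $ l $ j:]) = (\<Sum>l\<in>UNIV. R $ i $ l * D $ l $ j)" for i j
    proof -
      have "(\<Sum>l\<in>UNIV. R $ i $ l * D $ l $ j) = R $ i $ j * d j"
        by (simp add: D_def if_distrib[of "\<lambda>u. _ * u"] cong: if_cong)
      moreover have "(\<Sum>l\<in>UNIV. C $ i $ l * [:Q $ l $ j:]) = R $ i $ j * d j"
      proof -
        consider "j = p" | "j = q" | "j \<noteq> p" "j \<noteq> q" by blast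
        then show ?thesis
        proof cases
          case 1
          then show ?thesis using C_mult[OF u, of i] by (simp add: Q_def R_def d_def)
        next
          case 2
          then show ?thesis using C_mult[OF v, of i] pq by (simp add: Q_def R_def d_def)
        next
          case 3
          then have "[:Q $ l $ j:] = (if l = j then 1 else 0)" for l
            by (simp add: Q_def)
          with 3 show ?thesis
            by (simp add: R_def d_def if_distrib[of "\<lambda>u. _ * u"] cong: if_cong)
        qed
      qed
      ultimately show ?thesis by simp
    qed
    then show ?thesis by (simp add: matrix_matrix_mult_def vec_eq_iff)
  qed
  then have "char_polynomial A * [:det Q:] = det R * det D"
    by (metis C_def char_polynomial_def det_const_poly det_mul)
  moreover have "det D = [:-\<alpha>, 1:] * [:-\<beta>, 1:]"
  proof -
    have "det D = (\<Prod>j\<in>UNIV. d j)"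
      by (subst det_diagonal) (auto simp: D_def)
    also have "\<dots> = (\<Prod>j\<in>{p, q}. d j)"
      by (rule prod.mono_neutral_right) (auto simp: d_def)
    finally show ?thesis using pq by (simp add: d_def)
  qed
  \<comment> \<open>Rows \<open>p\<close> and \<open>q\<close> of \<open>Q *v z = 0\<close> form a
    2x2 system for \<open>z $ p\<close> and \<open>z $ q\<close> with nonzero determinant by
    \<open>indep\<close>; the other rows then give \<open>z $ i = 0\<close>.\<close>
  moreover have "det Q \<noteq> 0"
  proof -
    have "z = 0" if z: "Q *v z = 0" for z
    proof -
      have Qz: "z $ p * u $ i + z $ q * v $ i + (if i = p \<or> i = q then 0 else z $ i) = 0" for i
      proof -
        have "0 = (\<Sum>j\<in>UNIV. Q $ i $ j * z $ j)"
          using arg_cong[OF z, of "\<lambda>w. w $ i"] by (simp add: matrix_vector_mult_def)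
        also have "\<dots> = (\<Sum>j\<in>UNIV. (if j = p then z $ p * u $ i else 0)
            + (if j = q then z $ q * v $ i else 0)
            + (if j = i then (if i = p \<or> i = q then 0 else z $ i) else 0))"
          using pq by (intro sum.cong) (auto simp: Q_def)
        finally show ?thesis by (simp add: sum.distrib)
      qed
      have "z $ p * (u $ p * v $ q - u $ q * v $ p) = 0" "z $ q * (u $ p * v $ q - u $ q * v $ p) = 0"
        using Qz[of p] Qz[of q] by (simp_all, algebra+)
      with indep have "z $ p = 0" "z $ q = 0" by auto
      then have "z $ i = 0" for i
        using Qz[of i] by (cases "i = p \<or> i = q") auto
      then show ?thesis by (simp add: vec_eq_iff)
    qed
    then have "invertible Q"
      using invertible_left_inverse matrix_left_invertible_ker by blast
    then show ?thesis by (simp add: invertible_det_nz)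
  qed
  ultimately have "[:-\<alpha>, 1:] * [:-\<beta>, 1:] dvd char_polynomial A * [:det Q:]"
    by (metis dvd_triv_right)
  moreover have "is_unit [:det Q:]" using \<open>det Q \<noteq> 0\<close> by (simp add: is_unit_const_poly_iff dvd_field_iff)
  ultimately show ?thesis using dvd_mult_unit_iff by blast
qed

section \<open>The second smallest eigenvalue of a semidefinite matrix\<close>

lemma psd_char_polynomial_neg_nonzero:
  assumes "psd_matrix A" "x < 0"
  shows "poly (char_polynomial A) x \<noteq> 0"
proof -
  have "z = 0" if "(mat x - A) *v z = 0" for z
  proof -
    have "A *v z = x *\<^sub>R z"
      using that by (simp add: matrix_vector_mult_diff_rdistrib mat_mult_vector)
    then have "0 \<le> x * (z \<bullet> z)" using assms by (metis psd_matrix_def inner_scaleR_right)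
    with assms have "z \<bullet> z \<le> 0" by (simp add: zero_le_mult_iff)
    then show ?thesis by (simp add: inner_gt_zero_iff flip: not_less)
  qed
  then have "invertible (mat x - A)"
    using invertible_left_inverse matrix_left_invertible_ker by blast
  then show ?thesis by (simp add: poly_char_polynomial invertible_det_nz)
qed

text \<open>Two elements bounded by \<open>c\<close>, counted with multiplicity so that
  \<open>a = b\<close> is allowed, force the second entry of the sorted list below \<open>c\<close>.
  They also guarantee that index 1 is in range.\<close>

lemma sorted_list_of_multiset_nth_1:
  assumes "{#a, b#} \<subseteq># M" "a \<le> c" "b \<le> c"
  shows "sorted_list_of_multiset M ! 1 \<le> c" "sorted_list_of_multiset M ! 1 \<in># M"
proof -
  define xs where "xs = sorted_list_of_multiset M"
  have xs: "sorted xs" "mset xs = M" by (simp_all add: xs_def)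
  have len: "2 \<le> length xs"
    using size_mset_mono[OF assms(1)] by (simp flip: xs(2))
  have "2 \<le> length (filter (\<lambda>x. x \<le> c) xs)"
    using size_mset_mono[OF multiset_filter_mono[OF assms(1)], of "\<lambda>x. x \<le> c"] assms(2,3)
    by (simp flip: xs(2) mset_filter)
  moreover obtain x y ys where "xs = x # y # ys"
    using len by (auto simp: Suc_le_length_iff numeral_2_eq_2)
  \<comment> \<open>If the second entry exceeded \<open>c\<close>, so would all later ones, leaving
    at most one entry within the bound.\<close>
  moreover from this have "filter (\<lambda>x. x \<le> c) (y # ys) = []" if "\<not> y \<le> c"
    using xs(1) that by (fastforce simp: filter_empty_conv)
  ultimately show "sorted_list_of_multiset M ! 1 \<le> c"
    unfolding xs_def[symmetric] by (cases "y \<le> c") (auto split: if_splits)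
  show "sorted_list_of_multiset M ! 1 \<in># M"
    using len nth_mem[of 1 xs] unfolding xs_def[symmetric] by (simp flip: xs(2))
qed

text \<open>\<open>card\<close> excludes the 1x1 case, where the second eigenvalue is unspecified,
  and supplies a nonzero vector orthogonal to the all-ones vector. For \<open>A = 0\<close> the
  minimum \<open>\<mu>\<close> is 0, so the eigenvalue is squeezed between 0 and 0.\<close>

lemma second_eigenvalue_psd:
  fixes A :: "real^'n^'n"
  assumes psd: "psd_matrix A" and ones: "A *v (\<chi> i. 1) = 0" and card: "CARD('n) \<noteq> 1"
  shows "0 \<le> second_smallest_eigenvalue A"
    and "(\<Sum>i\<in>UNIV. z $ i) = 0 \<Longrightarrow> second_smallest_eigenvalue A * (z \<bullet> z) \<le> z \<bullet> (A *v z)"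
    and "A = 0 \<Longrightarrow> second_smallest_eigenvalue A = 0"
proof -
  define T :: "(real^'n) set" where "T = {z. z \<bullet> (\<chi> i. 1) = 0}"
  have T_iff: "z \<in> T \<longleftrightarrow> (\<Sum>i\<in>UNIV. z $ i) = 0" for z by (simp add: T_def inner_vec_def)
  have sym: "symmetric_matrix A" using psd by (simp add: psd_matrix_def)
  have T: "subspace T"
    by (simp add: T_def subspace_def inner_add_left)
  have inv: "A *v z \<in> T" if "z \<in> T" for z
    using symmetric_matrix_inner[OF sym, of z "\<chi> i. 1"] by (simp add: T_def ones)
  obtain a b :: 'n where ab: "a \<noteq> b"
    using card by (metis UNIV_I is_singletonI' is_singleton_altdef empty_iff)
  define w :: "real^'n" where "w = axis a 1 - axis b 1"
  have "w \<in> T" by (simp add: T_iff w_def sum_subtractf axis_def)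
  moreover have "w \<noteq> 0" using ab by (auto simp: w_def axis_eq_axis)
  ultimately obtain v where v: "v \<in> T" "norm v = 1"
    and min: "\<And>z. z \<in> T \<Longrightarrow> (v \<bullet> (A *v v)) * (z \<bullet> z) \<le> z \<bullet> (A *v z)"
    using quadratic_form_attains_min[OF T] by metis
  define \<mu> where "\<mu> = v \<bullet> (A *v v)"
  have ev: "A *v v = \<mu> *\<^sub>R v"
    unfolding \<mu>_def using sym T inv v min by (rule form_minimizer_eigenvector)
  \<comment> \<open>Two distinct entries of \<open>v\<close> give a nonzero 2x2 minor against the
    all-ones vector, the independence required below.\<close>
  have "\<exists>p q. v $ p \<noteq> v $ q"
  proof (rule ccontr)
    assume "\<nexists>p q. v $ p \<noteq> v $ q"
    then have c: "v $ i = v $ a" for i by auto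
    have "(\<Sum>i\<in>UNIV. v $ i) = of_nat CARD('n) * v $ a" by (subst c) simp
    with v(1) have "v $ a = 0" by (simp add: T_iff)
    with c have "v = 0" by (simp add: vec_eq_iff)
    with v show False by simp
  qed
  then obtain p q where "v $ p \<noteq> v $ q" by blast
  then have "[:-0, 1:] * [:-\<mu>, 1:] dvd char_polynomial A"
    using eigenvectors_char_polynomial_dvd[of A "\<chi> i. 1" 0 v \<mu> p q] ones ev by auto
  then obtain r where r: "char_polynomial A = [:0, 1:] * [:-\<mu>, 1:] * r"
    by (metis dvdE minus_zero)
  \<comment> \<open>Additivity of \<open>proots\<close> over products requires nonzero
    factors.\<close>
  have nz: "char_polynomial A \<noteq> 0"
    using psd_char_polynomial_neg_nonzero[OF psd, of "-1"] by auto
  have "proots (char_polynomial A) = {#0, \<mu>#} + proots r"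
  proof -
    have "[:0, 1:] * [:-\<mu>, 1:] \<noteq> (0 :: real poly)" "r \<noteq> 0" using nz by (auto simp: r)
    moreover have "proots ([:0, 1:] * [:-\<mu>, 1:]) = {#0, \<mu>#}"
      using proots_linear_factor[of "0::real"] proots_linear_factor[of "-\<mu>"]
      by (subst proots_mult) (simp_all add: add_mset_commute)
    ultimately show ?thesis unfolding r by (metis proots_mult)
  qed
  then have sub: "{#0, \<mu>#} \<subseteq># proots (char_polynomial A)" by simp
  have "0 \<le> \<mu>" using psd by (simp add: \<mu>_def psd_matrix_def)
  note second = sorted_list_of_multiset_nth_1[OF sub this order.refl,
      folded sorted_eigenvalues_def second_smallest_eigenvalue_def]
  \<comment> \<open>The second entry is a root of the characteristic polynomial, and no negative
    number is.\<close>
  show ge: "0 \<le> second_smallest_eigenvalue A"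
    using second(2) nz psd_char_polynomial_neg_nonzero[OF psd, of "second_smallest_eigenvalue A"]
    by (simp add: not_less[symmetric]) blast
  show "second_smallest_eigenvalue A * (z \<bullet> z) \<le> z \<bullet> (A *v z)" if "(\<Sum>i\<in>UNIV. z $ i) = 0"
    using min[of z] that second(1) mult_right_mono[OF second(1), of "z \<bullet> z"]
    by (simp add: T_iff \<mu>_def)
  show "second_smallest_eigenvalue A = 0" if "A = 0"
    using second(1) ge that by (simp add: \<mu>_def)
qed

section \<open>Unit matrices and the semidefinite condition on \<open>P\<close>\<close>

lemma matrix_mult_unit_matrix_component: "(P ** unit_matrix k) $ i $ j = (if j = k then P $ i $ k else 0)"
  for P :: "real^'n^'n"
  by (auto simp: matrix_matrix_mult_def unit_matrix_def axis_def if_distrib[of "\<lambda>u. _ * u"] cong: if_cong)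

lemma unit_matrix_mult_component: "(unit_matrix k ** P) $ i $ j = (if i = k then P $ k $ j else 0)"
  for P :: "real^'n^'n"
  by (auto simp: matrix_matrix_mult_def unit_matrix_def axis_def if_distrib[of "\<lambda>u. u * _"] cong: if_cong)

lemma sum_unit_matrix_mult_component:
  "((\<Sum>k\<in>UNIV. c k *\<^sub>R unit_matrix k) *v z) $ i = c i * (z $ i)"
proof -
  have "(\<Sum>k\<in>UNIV. c k *\<^sub>R unit_matrix k) $ i $ j = (if j = i then c i else 0)" for j
  proof -
    have "(\<Sum>k\<in>UNIV. c k *\<^sub>R unit_matrix k) $ i $ j =
        (\<Sum>k\<in>UNIV. if k = i then if j = i then c i else 0 else 0)"
      unfolding sum_component by (intro sum.cong) (auto simp: unit_matrix_def axis_def)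
    then show ?thesis by simp
  qed
  then show ?thesis
    by (simp add: matrix_vector_mult_def if_distrib[of "\<lambda>u. u * _"] cong: if_cong)
qed

text \<open>The diagonal of \<open>P E\<^sub>k + E\<^sub>k P\<close> vanishes off position \<open>k\<close>, and a semidefinite matrix with a
  zero on the diagonal has zeros in that whole row.\<close>

lemma psd_unit_matrix_anticommutator_row:
  fixes P :: "real^'n^'n"
  assumes psd: "psd_matrix (P ** unit_matrix k + unit_matrix k ** P)"
  shows "(P *v z) $ k = P $ k $ k * z $ k"
proof -
  define M where "M = P ** unit_matrix k + unit_matrix k ** P"
  have M: "M $ i $ j = (if j = k then P $ i $ k else 0) + (if i = k then P $ k $ j else 0)" for i j
    by (simp add: M_def matrix_mult_unit_matrix_component unit_matrix_mult_component)
  \<comment> \<open>Here \<open>M\<close> has diagonal entry 0 at \<open>a\<close>, while its entry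
    in row \<open>k\<close> and column \<open>a\<close> is \<open>P $ k $ a\<close>.\<close>
  have "P $ k $ a = 0" if "a \<noteq> k" for a
  proof -
    have "axis k 1 \<bullet> (M *v axis a 1) = 0"
    proof (rule nonneg_form_zero_imp_orthogonal)
      show "symmetric_matrix M" using psd by (simp add: M_def psd_matrix_def)
      show "axis a 1 \<bullet> (M *v axis a 1) = 0"
        using that by (simp add: matrix_vector_mult_basis inner_axis' column_def M)
    qed (use psd in \<open>simp add: M_def psd_matrix_def\<close>)
    then show ?thesis
      using that by (simp add: matrix_vector_mult_basis inner_axis' column_def M)
  qed
  then have "(P *v z) $ k = (\<Sum>a\<in>UNIV. if a = k then P $ k $ k * z $ k else 0)"
    unfolding matrix_vector_mult_def vec_lambda_beta by (intro sum.cong) auto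
  then show ?thesis by simp
qed

section \<open>Contraction and coupling estimates, and a differential inequality\<close>

lemma generalized_laplacian_ones:
  assumes "generalized_laplacian A"
  shows "A *v (\<chi> i. 1) = 0"
  using assms laplacian_ones unfolding generalized_laplacian_def by blast

text \<open>The mean value equality fails for vector-valued maps but holds for the scalar map
  \<open>u \<bullet> f\<close> along the segment; \<open>\<xi>\<close> therefore depends on
  \<open>u\<close>.\<close>

lemma inner_mvt_jacobian:
  fixes f :: "real^'n \<Rightarrow> real^'m"
  assumes f: "\<And>x. f differentiable (at x)"
  obtains \<xi> where "\<xi> \<in> closed_segment a b"
    "u \<bullet> (f b - f a) = u \<bullet> (jacobian f (at \<xi>) *v (b - a))"
proof -
  define p where "p s = a + s *\<^sub>R (b - a)" for s :: real
  have "((\<lambda>s. u \<bullet> f (p s)) has_derivative (\<lambda>h. u \<bullet> (jacobian f (at (p s)) *v (h *\<^sub>R (b - a))))) (at s)" for s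
  proof -
    have "(f has_derivative (\<lambda>h. jacobian f (at (p s)) *v h)) (at (p s))"
      using f jacobian_works by blast
    moreover have "(p has_derivative (\<lambda>h. h *\<^sub>R (b - a))) (at s)"
      unfolding p_def by (auto intro!: derivative_eq_intros)
    ultimately show ?thesis
      using has_derivative_compose has_derivative_inner_right by blast
  qed
  then obtain s :: real where "s \<in> {0<..<1}"
    "u \<bullet> f (p 1) - u \<bullet> f (p 0) = u \<bullet> (jacobian f (at (p s)) *v ((1 - 0) *\<^sub>R (b - a)))"
    using mvt[of 0 1 "\<lambda>s. u \<bullet> f (p s)" "\<lambda>s h. u \<bullet> (jacobian f (at (p s)) *v (h *\<^sub>R (b - a)))"]
    by (smt (verit) continuous_at_imp_continuous_on differentiable_imp_continuous_within
        differentiable_def greaterThanLessThan_iff)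
  moreover from this have "p s \<in> closed_segment a b"
    unfolding closed_segment_def by (auto simp: p_def algebra_simps intro!: exI[of _ s])
  ultimately show thesis using that[of "p s"] by (simp add: p_def inner_diff_right)
qed

text \<open>As \<open>P\<close> is symmetric, the two summands in \<open>le\<close> have the same
  quadratic form at \<open>z\<close>; halving produces \<open>\<epsilon> / 2\<close>.\<close>

lemma loewner_contraction_bound:
  fixes P A \<Lambda> :: "real^'n^'n"
  assumes sym: "symmetric_matrix P"
    and le: "P ** (A - \<Lambda>) + transpose (A - \<Lambda>) ** P \<preceq>\<^sub>L - (\<epsilon> *\<^sub>R mat 1)"
  shows "(P *v z) \<bullet> (A *v z) \<le> (P *v z) \<bullet> (\<Lambda> *v z) - \<epsilon> / 2 * (z \<bullet> z)"
proof -
  define B where "B = A - \<Lambda>"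
  have "psd_matrix (- (\<epsilon> *\<^sub>R mat 1) - (P ** B + transpose B ** P))"
    using le by (simp add: loewner_le_def B_def)
  then have "0 \<le> z \<bullet> ((- (\<epsilon> *\<^sub>R mat 1) - (P ** B + transpose B ** P)) *v z)"
    by (simp add: psd_matrix_def)
  also have "\<dots> = - \<epsilon> * (z \<bullet> z) - z \<bullet> (P *v (B *v z)) - z \<bullet> (transpose B *v (P *v z))"
  proof -
    have "- (\<epsilon> *\<^sub>R mat 1) *v z = - \<epsilon> *\<^sub>R z"
      using scaleR_matrix_vector_assoc[of "- \<epsilon>" "mat 1" z] by simp
    then show ?thesis
      by (simp add: matrix_vector_mult_diff_rdistrib matrix_vector_mult_add_rdistrib
          inner_diff_right inner_add_right flip: matrix_vector_mul_assoc)
  qed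
  also have "z \<bullet> (transpose B *v (P *v z)) = (P *v z) \<bullet> (B *v z)"
    by (metis dot_lmul_matrix inner_commute transpose_matrix_vector)
  also have "z \<bullet> (P *v (B *v z)) = (P *v z) \<bullet> (B *v z)"
    by (rule symmetric_matrix_inner[OF sym])
  finally show ?thesis
    by (simp add: B_def matrix_vector_mult_diff_rdistrib inner_diff_right)
qed

text \<open>For \<open>L = 0\<close> both sides vanish. Otherwise the row property of
  \<open>P\<close> makes both sides \<open>P $ k $ k\<close> times those of the eigenvalue bound for
  \<open>L\<close> on vectors summing to zero.\<close>

lemma coupling_dissipation:
  fixes L :: "real^'N^'N" and P :: "real^'n^'n" and y :: "'N \<Rightarrow> real^'n"
  assumes lap: "generalized_laplacian L" and psd: "psd_matrix L" and card: "CARD('N) \<noteq> 1"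
    and P: "pd_matrix P"
    and PE: "L \<noteq> 0 \<Longrightarrow> psd_matrix (P ** unit_matrix k + unit_matrix k ** P)"
    and y: "(\<Sum>i\<in>UNIV. y i) = 0"
  shows "second_smallest_eigenvalue L * (\<Sum>i\<in>UNIV. (P *v y i) $ k * y i $ k)
    \<le> (\<Sum>i\<in>UNIV. (P *v y i) $ k * (L *v (\<chi> j. y j $ k)) $ i)"
proof (cases "L = 0")
  case True
  then show ?thesis
    using second_eigenvalue_psd(3)[OF psd generalized_laplacian_ones[OF lap] card] by simp
next
  case False
  define z where "z = (\<chi> j. y j $ k)"
  \<comment> \<open>This diagonal entry is the form of \<open>P\<close> at
    \<open>axis k 1\<close>.\<close>
  have "0 < P $ k $ k"
    using P unfolding pd_matrix_def
    by (metis axis_eq_0_iff cart_eq_inner_axis column_def inner_commute matrix_vector_mult_basis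
        vec_lambda_beta zero_neq_one)
  moreover have "(\<Sum>i\<in>UNIV. z $ i) = 0"
    using arg_cong[OF y, of "\<lambda>v. v $ k"] by (simp add: z_def)
  ultimately have "P $ k $ k * (second_smallest_eigenvalue L * (z \<bullet> z)) \<le> P $ k $ k * (z \<bullet> (L *v z))"
    by (intro mult_left_mono second_eigenvalue_psd(2)[OF psd generalized_laplacian_ones[OF lap] card])
      simp_all
  then show ?thesis
    unfolding psd_unit_matrix_anticommutator_row[OF PE[OF False]] z_def[symmetric]
    by (simp add: inner_vec_def z_def sum_distrib_left algebra_simps)
qed

text \<open>Gronwall by an integrating factor: \<open>V t * exp (a * t)\<close> has nonpositive
  derivative.\<close>

lemma exponential_decay:
  fixes V V' :: "real \<Rightarrow> real"
  assumes deriv: "\<And>t. t \<ge> 0 \<Longrightarrow> (V has_real_derivative V' t) (at t within {0..})"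
    and le: "\<And>t. t \<ge> 0 \<Longrightarrow> V' t \<le> - a * V t" and "t \<ge> 0"
  shows "V t \<le> V 0 * exp (- a * t)"
proof -
  define W where "W t = V t * exp (a * t)" for t
  have W: "(W has_real_derivative (V' t + a * V t) * exp (a * t)) (at t within {0..})" if "t \<ge> 0" for t
    unfolding W_def by (rule derivative_eq_intros deriv that refl | simp add: algebra_simps)+
  have "W t \<le> W 0"
  \<comment> \<open>At interior points the derivative within \<open>{0..}\<close> is two-sided; at 0
    continuity suffices.\<close>
  proof (rule DERIV_nonpos_imp_decreasing_open[OF \<open>t \<ge> 0\<close>])
    fix x assume x: "0 < x" "x < t"
    then have "(W has_real_derivative (V' x + a * V x) * exp (a * x)) (at x)"
      using W[of x] by (simp add: at_within_interior[of x "{0..}"])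
    moreover have "(V' x + a * V x) * exp (a * x) \<le> 0"
      using le[of x] x by (intro mult_nonpos_nonneg) auto
    ultimately show "\<exists>y. (W has_real_derivative y) (at x) \<and> y \<le> 0" by blast
  next
    have "continuous_on {0..} W"
      by (rule DERIV_continuous_on[OF W]) simp
    then show "continuous_on {0..t} W" by (rule continuous_on_subset) auto
  qed
  then show ?thesis by (simp add: W_def exp_minus field_simps)
qed

text \<open>A static inequality for arbitrary states in \<open>S\<close>. Along a solution its left
  side is half the derivative of the Lyapunov function, since the derivative of the mean
  cancels.\<close>

lemma contraction_dissipation:
  fixes f :: "real^'n \<Rightarrow> real^'n" and L :: "'n \<Rightarrow> real^'N^'N" and P :: "real^'n^'n"
    and x :: "'N \<Rightarrow> real^'n"
  defines "m \<equiv> (\<Sum>i\<in>UNIV. x i) /\<^sub>R CARD('N)"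
  assumes f: "\<And>x. f differentiable (at x)"
    and lap: "\<And>k. generalized_laplacian (L k)" and psd: "\<And>k. psd_matrix (L k)"
    and card: "CARD('N) \<noteq> 1"
    and S: "convex S" "\<And>i. x i \<in> S"
    and P: "pd_matrix P"
    and J: "\<And>x. x \<in> S \<Longrightarrow>
      P ** (jacobian f (at x) - (\<Sum>k\<in>UNIV. second_smallest_eigenvalue (L k) *\<^sub>R unit_matrix k))
      + transpose (jacobian f (at x) - (\<Sum>k\<in>UNIV. second_smallest_eigenvalue (L k) *\<^sub>R unit_matrix k)) ** P
      \<preceq>\<^sub>L - (\<epsilon> *\<^sub>R mat 1)"
    and PE: "\<And>k. L k \<noteq> 0 \<Longrightarrow> psd_matrix (P ** unit_matrix k + unit_matrix k ** P)"
  shows "(\<Sum>i\<in>UNIV. (P *v (x i - m)) \<bullet> (f (x i) - (\<chi> k. (L k *v (\<chi> j. x j $ k)) $ i)))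
    \<le> - (\<epsilon> / 2) * (\<Sum>i\<in>UNIV. (x i - m) \<bullet> (x i - m))"
proof -
  define y where "y i = x i - m" for i
  define \<Lambda> :: "real^'n^'n" where "\<Lambda> = (\<Sum>k\<in>UNIV. second_smallest_eigenvalue (L k) *\<^sub>R unit_matrix k)"
  define c where "c i = (\<chi> k. (L k *v (\<chi> j. x j $ k)) $ i)" for i
  have sym: "symmetric_matrix P" using P by (simp add: pd_matrix_def)
  have y0: "(\<Sum>i\<in>UNIV. y i) = 0" by (simp add: y_def m_def sum_deviations_from_mean)
  \<comment> \<open>By convexity the segments from \<open>m\<close> to the states then stay in
    \<open>S\<close>, where \<open>J\<close> applies.\<close>
  have "m \<in> S"
    unfolding m_def scaleR_right.sum using S by (intro convex_sum) auto

  have 1: "(P *v y i) \<bullet> (f (x i) - f m) \<le> (P *v y i) \<bullet> (\<Lambda> *v y i) - \<epsilon> / 2 * (y i \<bullet> y i)" for i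
  proof -
    obtain \<xi> where \<xi>: "\<xi> \<in> closed_segment m (x i)"
      "(P *v y i) \<bullet> (f (x i) - f m) = (P *v y i) \<bullet> (jacobian f (at \<xi>) *v (x i - m))"
      using inner_mvt_jacobian[OF f] by metis
    then have "\<xi> \<in> S" using S \<open>m \<in> S\<close> closed_segment_subset by blast
    then show ?thesis
      using loewner_contraction_bound[OF sym J, of \<xi> "y i"] \<xi>(2) by (simp add: \<Lambda>_def y_def)
  qed
  have 2: "(\<Sum>i\<in>UNIV. (P *v y i) \<bullet> (\<Lambda> *v y i)) \<le> (\<Sum>i\<in>UNIV. (P *v y i) \<bullet> c i)"
  proof -
    \<comment> \<open>\<open>L k\<close> annihilates constant vectors, so the coupling sees only
      deviations.\<close>
    have c: "c i $ k = (L k *v (\<chi> j. y j $ k)) $ i" for i k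
    proof -
      have "(\<chi> j. x j $ k) = (\<chi> j. y j $ k) + m $ k *\<^sub>R (\<chi> j. 1)"
        by (simp add: vec_eq_iff y_def)
      then show ?thesis
        using generalized_laplacian_ones[OF lap, of k]
        by (simp add: c_def matrix_vector_right_distrib matrix_vector_mult_scaleR)
    qed
    \<comment> \<open>\<open>\<Lambda>\<close> is diagonal, so the form splits by component, and
      each \<open>L k\<close> can be treated separately.\<close>
    have "(\<Sum>i\<in>UNIV. (P *v y i) \<bullet> (\<Lambda> *v y i)) =
        (\<Sum>k\<in>UNIV. second_smallest_eigenvalue (L k) * (\<Sum>i\<in>UNIV. (P *v y i) $ k * y i $ k))"
      unfolding inner_vec_def \<Lambda>_def sum_unit_matrix_mult_component sum_distrib_left
      by (subst sum.swap) (simp add: mult_ac)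
    also have "\<dots> \<le> (\<Sum>k\<in>UNIV. \<Sum>i\<in>UNIV. (P *v y i) $ k * c i $ k)"
      unfolding c by (intro sum_mono coupling_dissipation lap psd card P PE y0)
    also have "\<dots> = (\<Sum>i\<in>UNIV. (P *v y i) \<bullet> c i)"
      unfolding inner_vec_def by (subst sum.swap) simp
    finally show ?thesis .
  qed
  \<comment> \<open>This permits subtracting \<open>f m\<close> from every
    \<open>f (x i)\<close>.\<close>
  have 3: "(\<Sum>i\<in>UNIV. (P *v y i) \<bullet> f m) = 0"
    by (simp add: y0 flip: inner_sum_left linear_sum[OF matrix_vector_mul_linear])
  have "(\<Sum>i\<in>UNIV. (P *v y i) \<bullet> (f (x i) - c i)) =
      (\<Sum>i\<in>UNIV. (P *v y i) \<bullet> (f (x i) - f m)) - (\<Sum>i\<in>UNIV. (P *v y i) \<bullet> c i)"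
    using 3 by (simp add: inner_diff_right sum_subtractf)
  also have "(\<Sum>i\<in>UNIV. (P *v y i) \<bullet> (f (x i) - f m)) \<le>
      (\<Sum>i\<in>UNIV. (P *v y i) \<bullet> (\<Lambda> *v y i) - \<epsilon> / 2 * (y i \<bullet> y i))"
    by (intro sum_mono 1)
  also have "\<dots> = (\<Sum>i\<in>UNIV. (P *v y i) \<bullet> (\<Lambda> *v y i)) - \<epsilon> / 2 * (\<Sum>i\<in>UNIV. y i \<bullet> y i)"
    by (simp only: sum_subtractf sum_distrib_left)
  finally show ?thesis
    using 2 by (simp add: y_def c_def)
qed

section \<open>Derivatives along solutions and exponential synchronization\<close>

lemma compartmental_solution_block:
  fixes X :: "real \<Rightarrow> real^('N::finite \<times> 'n::finite)"
  assumes "compartmental_solution f L X" "t \<ge> 0"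
  shows "((\<lambda>t. block (X t) i) has_vector_derivative
    f (block (X t) i) - (\<chi> k. (L k *v (\<chi> j. block (X t) j $ k)) $ i)) (at t within {0..})"
proof -
  have "bounded_linear (\<lambda>X :: real^('N \<times> 'n). block X i)"
    by (rule linear_conv_bounded_linear[THEN iffD1]) (auto intro!: linearI simp: block_def vec_eq_iff)
  from bounded_linear.has_vector_derivative[OF this, of X] assms
  have "((\<lambda>t. block (X t) i) has_vector_derivative
      block (stacked_map f (X t) - (\<Sum>k\<in>UNIV. L k \<otimes>\<^sub>K unit_matrix k) *v X t) i) (at t within {0..})"
    unfolding compartmental_solution_def by blast
  moreover have "block (stacked_map f (X t) - (\<Sum>k\<in>UNIV. L k \<otimes>\<^sub>K unit_matrix k) *v X t) i =
      f (block (X t) i) - (\<chi> k. (L k *v (\<chi> j. block (X t) j $ k)) $ i)"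
    by (subst block_def, subst compartmental_component) (simp add: vec_eq_iff block_def)
  ultimately show ?thesis by simp
qed

lemma has_real_derivative_quadratic_form:
  fixes P :: "real^'n^'n"
  assumes sym: "symmetric_matrix P" and y: "(y has_vector_derivative y') (at t within T)"
  shows "((\<lambda>t. y t \<bullet> (P *v y t)) has_real_derivative 2 * ((P *v y t) \<bullet> y')) (at t within T)"
proof -
  have "((\<lambda>t. y t \<bullet> (P *v y t)) has_vector_derivative (y t \<bullet> (P *v y') + y' \<bullet> (P *v y t))) (at t within T)"
    by (rule bounded_bilinear.has_vector_derivative[OF bounded_bilinear_inner y]
        bounded_linear.has_vector_derivative[OF matrix_vector_mul_bounded_linear y])+
  moreover have "y t \<bullet> (P *v y') + y' \<bullet> (P *v y t) = 2 * ((P *v y t) \<bullet> y')"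
    using symmetric_matrix_inner[OF sym, of "y t" y'] by (simp add: inner_commute)
  ultimately show ?thesis by (simp add: has_real_derivative_iff_has_vector_derivative)
qed

theorem proposition2p1:
  fixes f :: "real^'n \<Rightarrow> real^'n"
    and L :: "'n \<Rightarrow> real^'N^'N"
    and S :: "(real^'n) set"
    and P :: "real^'n^'n"
    and \<epsilon> :: real
    and J :: "real^'n \<Rightarrow> real^'n^'n"
    and \<Lambda> :: "real^'n^'n"
    and X :: "real \<Rightarrow> real^('N::finite \<times> 'n::finite)"
    and i j :: 'N
    and k :: 'n
  defines "J \<equiv> \<lambda>x. jacobian f (at x)"
    and "\<Lambda> \<equiv> \<Sum>k\<in>UNIV. second_smallest_eigenvalue (L k) *\<^sub>R unit_matrix k"
  assumes "continuously_differentiable f"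
    and "\<And>k. generalized_laplacian (L k)"
    and "\<And>k. psd_matrix (L k)"
    and "convex S"
    and "pd_matrix P"
    and "\<epsilon> > 0"
    and "\<And>x. x \<in> S \<Longrightarrow>
           P ** (J x - \<Lambda>) + transpose (J x - \<Lambda>) ** P \<preceq>\<^sub>L - (\<epsilon> *\<^sub>R mat 1)"
    and "\<And>k. L k \<noteq> 0 \<Longrightarrow> 0 \<preceq>\<^sub>L P ** unit_matrix k + unit_matrix k ** P"
    and "compartmental_solution f L X"
    and "\<And>t i. t \<ge> 0 \<Longrightarrow> block (X t) i \<in> S"
  shows "tends_to_0_exponentially (\<lambda>t. X t $ (i, k) - X t $ (j, k))"
\<comment> \<open>The case \<open>i = j\<close> absorbs a single compartment, where the second
  eigenvalue is unspecified.\<close>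
proof (cases "i = j")
  case True
  then show ?thesis
    by (auto simp: tends_to_0_exponentially_def intro!: exI[of _ 1])
next
  case False
  then have card: "CARD('N) \<noteq> 1" by (metis UNIV_I card_1_singletonE singletonD)
  have sym: "symmetric_matrix P" using \<open>pd_matrix P\<close> by (simp add: pd_matrix_def)
  define x where "x l t = block (X t) l" for l t
  define g where "g l t = f (x l t) - (\<chi> k. (L k *v (\<chi> j. x j t $ k)) $ l)" for l t
  define y where "y l t = x l t - (\<Sum>l\<in>UNIV. x l t) /\<^sub>R CARD('N)" for l t
  define V where "V t = (\<Sum>l\<in>UNIV. y l t \<bullet> (P *v y l t))" for t

  have dV: "(V has_real_derivative 2 * (\<Sum>l\<in>UNIV. (P *v y l t) \<bullet> g l t)) (at t within {0..})"
    if "t \<ge> 0" for t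
  proof -
    define h where "h = (\<Sum>l\<in>UNIV. g l t) /\<^sub>R CARD('N)"
    have "(x l has_vector_derivative g l t) (at t within {0..})" for l
      using compartmental_solution_block[OF \<open>compartmental_solution f L X\<close> that, of l]
      by (simp add: x_def[abs_def] g_def)
    then have "(y l has_vector_derivative g l t - h) (at t within {0..})" for l
      unfolding y_def h_def
      by (intro has_vector_derivative_diff has_vector_derivative_sum
          bounded_linear.has_vector_derivative[OF bounded_linear_scaleR_right])
    then have "(V has_real_derivative (\<Sum>l\<in>UNIV. 2 * ((P *v y l t) \<bullet> (g l t - h)))) (at t within {0..})"
      unfolding V_def by (intro DERIV_sum has_real_derivative_quadratic_form[OF sym])
    \<comment> \<open>The derivative \<open>h\<close> of the mean is common to all compartments, so
      it cancels against deviations summing to zero.\<close>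
    moreover have "(\<Sum>l\<in>UNIV. (P *v y l t) \<bullet> h) = 0"
    proof -
      have "(\<Sum>l\<in>UNIV. y l t) = 0" by (simp add: y_def sum_deviations_from_mean)
      then show ?thesis
        by (simp flip: inner_sum_left linear_sum[OF matrix_vector_mul_linear])
    qed
    ultimately show ?thesis
      by (simp add: inner_diff_right sum_subtractf flip: sum_distrib_left)
  qed

  \<comment> \<open>The minimum of the form of \<open>P\<close> on unit vectors lets
    \<open>V\<close> control the deviations; \<open>axis k 1\<close> merely exhibits a nonzero
    vector.\<close>
  obtain v where v: "norm v = 1" and min: "\<And>z. (v \<bullet> (P *v v)) * (z \<bullet> z) \<le> z \<bullet> (P *v z)"
    using quadratic_form_attains_min[OF subspace_UNIV, of "axis k 1" P]
    by (metis UNIV_I axis_eq_0_iff zero_neq_one)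
  define p where "p = v \<bullet> (P *v v)"
  have p: "p > 0" using \<open>pd_matrix P\<close> v unfolding p_def pd_matrix_def by (metis norm_zero zero_neq_one)
  obtain K where K: "K > 0" "\<And>z. norm (P *v z) \<le> norm z * K"
    using bounded_linear.pos_bounded[OF matrix_vector_mul_bounded_linear[of P]] by blast
  \<comment> \<open>The derivative of \<open>V\<close> is at most \<open>- \<epsilon>\<close> times
    the sum of the squared deviations, and that sum is at least \<open>V t / K\<close>.\<close>
  define a where "a = \<epsilon> / K"
  have a: "a > 0" using K \<open>\<epsilon> > 0\<close> by (simp add: a_def)

  have "2 * (\<Sum>l\<in>UNIV. (P *v y l t) \<bullet> g l t) \<le> - a * V t" if "t \<ge> 0" for t
  proof -
    have "(\<Sum>l\<in>UNIV. (P *v y l t) \<bullet> g l t) \<le> - (\<epsilon> / 2) * (\<Sum>l\<in>UNIV. y l t \<bullet> y l t)"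
      unfolding y_def g_def
      using assms that card
      by (intro contraction_dissipation[where S = S])
        (auto simp: x_def continuously_differentiable_def loewner_le_def)
    moreover have "V t \<le> K * (\<Sum>l\<in>UNIV. y l t \<bullet> y l t)"
      unfolding V_def sum_distrib_left
    proof (rule sum_mono)
      fix l
      have "y l t \<bullet> (P *v y l t) \<le> norm (y l t) * (norm (y l t) * K)"
        by (rule order_trans[OF norm_cauchy_schwarz mult_left_mono[OF K(2)]]) simp
      then show "y l t \<bullet> (P *v y l t) \<le> K * (y l t \<bullet> y l t)"
        by (simp add: dot_square_norm power2_eq_square mult_ac)
    qed
    then have "a * V t \<le> a * (K * (\<Sum>l\<in>UNIV. y l t \<bullet> y l t))"
      using a by (intro mult_left_mono) auto
    then have "a * V t \<le> \<epsilon> * (\<Sum>l\<in>UNIV. y l t \<bullet> y l t)"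
      using K by (simp add: a_def)
    ultimately show ?thesis by simp
  qed
  then have decay: "V t \<le> V 0 * exp (- a * t)" if "t \<ge> 0" for t
    using dV that by (intro exponential_decay[where a = a]) auto

  \<comment> \<open>Taking the square root of the bound on \<open>V\<close> halves the rate; the
    summand 1 keeps the constant positive when \<open>V 0 = 0\<close>.\<close>
  have "\<bar>X t $ (i, k) - X t $ (j, k)\<bar> \<le> (2 * sqrt (V 0 / p) + 1) * exp (- (a / 2) * t)" if "t \<ge> 0" for t
  proof -
    have y: "norm (y l t) \<le> sqrt (V 0 / p) * exp (- (a / 2) * t)" for l
    proof -
      have "p * (y l t \<bullet> y l t) \<le> y l t \<bullet> (P *v y l t)"
        using min by (simp add: p_def)
      also have "\<dots> \<le> V t"
      proof -
        have "0 \<le> y l t \<bullet> (P *v y l t)" for l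
          using \<open>pd_matrix P\<close> by (cases "y l t = 0") (auto simp: pd_matrix_def less_imp_le)
        then show ?thesis unfolding V_def by (intro member_le_sum) auto
      qed
      finally have "(norm (y l t))\<^sup>2 \<le> V 0 / p * exp (- a * t)"
        using decay[OF that] p by (simp add: dot_square_norm field_simps)
      also have "exp (- a * t) = (exp (- (a / 2) * t))\<^sup>2"
        by (simp flip: exp_double)
      finally have "norm (y l t) \<le> sqrt (V 0 / p * (exp (- (a / 2) * t))\<^sup>2)"
        by (rule real_le_rsqrt)
      also have "\<dots> = sqrt (V 0 / p) * exp (- (a / 2) * t)"
        by (subst real_sqrt_mult) simp
      finally show ?thesis .
    qed
    have "\<bar>X t $ (i, k) - X t $ (j, k)\<bar> = \<bar>(y i t - y j t) $ k\<bar>"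
      by (simp add: y_def x_def block_def)
    also have "\<dots> \<le> norm (y i t) + norm (y j t)"
      using component_le_norm_cart norm_triangle_ineq4 order_trans by blast
    also have "\<dots> \<le> (2 * sqrt (V 0 / p)) * exp (- (a / 2) * t)"
      using y[of i] y[of j] by simp
    also have "\<dots> \<le> (2 * sqrt (V 0 / p) + 1) * exp (- (a / 2) * t)" by simp
    finally show ?thesis .
  qed
  moreover have "0 \<le> V 0"
    unfolding V_def using \<open>pd_matrix P\<close>
    by (intro sum_nonneg) (metis inner_zero_left less_imp_le order.refl pd_matrix_def)
  then have "2 * sqrt (V 0 / p) + 1 > 0" using p by (simp add: add_nonneg_pos)
  ultimately show ?thesis
    unfolding tends_to_0_exponentially_def using a
    by (intro exI[of _ "2 * sqrt (V 0 / p) + 1"] conjI exI[of _ "a / 2"]) auto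
qed

end
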